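(* Let $\langle\mathrm{Proc},\Sigma,\to\rangle$ be a labelled transition system over a finite alphabet $\Sigma$, and let $L\subseteq\mathrm{Proc}$. The following are equivalent: (i) $L\in\tau_O$; (ii) $L$ is multi-trace monitorable in the topological sense; (iii) $L$ is multi-trace monitorable in the operational sense.
   Context: A labelled transition system is $\langle \mathrm{Proc},\Sigma,\to\rangle$ with $\to\subseteq \mathrm{Proc}\times\Sigma\times\mathrm{Proc}$. For a process $p$, a finite word $a_1\cdots a_n\in\Sigma^*$ belongs to $\mathrm{Trc}(p)\cap\Sigma^*$ iff there are processes with $p=p_0\xrightarrow{a_1}p_1\cdots\xrightarrow{a_n}p_n$ (the empty word always belongs). For $s\in\Sigma^*$, $O(s)=\{p\in\mathrm{Proc}\mid s\in\mathrm{Trc}(p)\}$, and $\tau_O$ is the smallest topology on $\mathrm{Proc}$ containing all sets $O(s)$, $s\in\Sigma^*$. $\mathcal P_f(\Sigma^* )$ is the set of finite subsets of $\Sigma^*$. The empty intersection $\bigcap_{s\in\varnothing}O(s)$ is $\mathrm{Proc}$. Topological sense. A (topological) multi-trace monitor for $L$ is a function $m:\mathcal P_f(\Sigma^* )\to\{\mathsf{yes},\mathsf{?}\}$ such that for all $C,D\in\mathcal P_f(\Sigma^* )$: if $m(D)=\mathsf{yes}$ then $\bigcap_{s\in D}O(s)\subseteq L$; and if $m(C)=\mathsf{yes}$ and $C\subseteq D$ then $m(D)=\mathsf{yes}$. $L$ is multi-trace monitorable in the topological sense if there is such a monitor $m$ for $L$ such that for every $p\in L$ there is a finite set $D\subseteq\mathrm{Trc}(p)\cap\Sigma^*$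 with $m(D)=\mathsf{yes}$. Operational sense. An (operational) multi-trace monitor is a set $m\subseteq\mathcal P_f(\Sigma^* )$ such that for all $C,D\in\mathcal P_f(\Sigma^* )$, if $C\in m$ and $C\subseteq D$ then $D\in m$. For $p\in\mathrm{Proc}$, $\mathrm{acc}_m(p)$ holds iff there exists $D\subseteq\mathrm{Trc}(p)\cap\Sigma^*$ with $D\in m$. The monitor $m$ is sound for $L$ if for every $p\in\mathrm{Proc}$, $\mathrm{acc}_m(p)$ implies $p\in L$. $L$ is multi-trace monitorable in the operational sense if there is an operational multi-trace monitor $m$ that is sound for $L$ and such that $\mathrm{acc}_m(p)$ holds for every $p\in L$. *)

theory Defs
  imports "HOL-Analysis.Analysis"
begin

text \<open>
  A labelled transition system is given by carrier sets \<open>Proc\<close> and \<open>\<Sigma>\<close> and a transition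
  relation \<open>T\<close>; finite words over \<open>\<Sigma>\<close> are the elements of \<^term>\<open>lists \<Sigma>\<close>.
\<close>

definition lts :: "'p set \<Rightarrow> 'a set \<Rightarrow> ('p \<times> 'a \<times> 'p) set \<Rightarrow> bool" where
  "lts Proc \<Sigma> T \<longleftrightarrow> T \<subseteq> Proc \<times> \<Sigma> \<times> Proc"

definition fin_traces :: "'p set \<Rightarrow> 'a set \<Rightarrow> ('p \<times> 'a \<times> 'p) set \<Rightarrow> 'p \<Rightarrow> 'a list set" where
  "fin_traces Proc \<Sigma> T p =
     {w \<in> lists \<Sigma>. \<exists>q. q 0 = p \<and> (\<forall>i\<le>length w. q i \<in> Proc) \<and>
                     (\<forall>i<length w. (q i, w ! i, q (Suc i)) \<in> T)}"

definition obs :: "'p set \<Rightarrow> 'a set \<Rightarrow> ('p \<times> 'a \<times> 'p) set \<Rightarrow> 'a list \<Rightarrow> 'p set" where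
  "obs Proc \<Sigma> T s = {p \<in> Proc. s \<in> fin_traces Proc \<Sigma> T p}"

text \<open>
  The space underlying \<^const>\<open>topology_generated_by\<close> is the union of the generating sets. Here it
  is \<open>Proc\<close>, because the empty word is a trace of every process.
\<close>

definition obs_topology :: "'p set \<Rightarrow> 'a set \<Rightarrow> ('p \<times> 'a \<times> 'p) set \<Rightarrow> 'p topology" where
  "obs_topology Proc \<Sigma> T = topology_generated_by (obs Proc \<Sigma> T ` lists \<Sigma>)"

lemma topspace_obs_topology: "topspace (obs_topology Proc \<Sigma> T) = Proc"
proof -
  have "obs Proc \<Sigma> T [] = Proc"
    by (auto simp: obs_def fin_traces_def intro: exI[of _ "\<lambda>_. _"])
  then show ?thesis
    by (force simp: obs_topology_def obs_def topology_generated_by_topspace)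
qed

definition fin_word_sets :: "'a set \<Rightarrow> 'a list set set" where
  "fin_word_sets \<Sigma> = {D. finite D \<and> D \<subseteq> lists \<Sigma>}"

datatype verdict = Yes | Unknown

text \<open>
  Topological monitors are functions on \<^term>\<open>fin_word_sets \<Sigma>\<close>; their values at other sets are
  irrelevant. Intersecting with \<open>Proc\<close> matters only for \<open>D = {}\<close>, where the intersection
  is by convention \<open>Proc\<close>.
\<close>

definition top_monitor ::
  "'p set \<Rightarrow> 'a set \<Rightarrow> ('p \<times> 'a \<times> 'p) set \<Rightarrow> 'p set \<Rightarrow> ('a list set \<Rightarrow> verdict) \<Rightarrow> bool" where
  "top_monitor Proc \<Sigma> T L m \<longleftrightarrow>
     (\<forall>C \<in> fin_word_sets \<Sigma>. \<forall>D \<in> fin_word_sets \<Sigma>.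
        (m D = Yes \<longrightarrow> Proc \<inter> (\<Inter>s\<in>D. obs Proc \<Sigma> T s) \<subseteq> L) \<and>
        (m C = Yes \<and> C \<subseteq> D \<longrightarrow> m D = Yes))"

definition top_monitorable ::
  "'p set \<Rightarrow> 'a set \<Rightarrow> ('p \<times> 'a \<times> 'p) set \<Rightarrow> 'p set \<Rightarrow> bool" where
  "top_monitorable Proc \<Sigma> T L \<longleftrightarrow>
     (\<exists>m. top_monitor Proc \<Sigma> T L m \<and>
          (\<forall>p\<in>L. \<exists>D. finite D \<and> D \<subseteq> fin_traces Proc \<Sigma> T p \<and> m D = Yes))"

definition op_monitor :: "'a set \<Rightarrow> 'a list set set \<Rightarrow> bool" where
  "op_monitor \<Sigma> m \<longleftrightarrow>
     m \<subseteq> fin_word_sets \<Sigma> \<and>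
     (\<forall>C \<in> fin_word_sets \<Sigma>. \<forall>D \<in> fin_word_sets \<Sigma>. C \<in> m \<and> C \<subseteq> D \<longrightarrow> D \<in> m)"

definition op_acc ::
  "'p set \<Rightarrow> 'a set \<Rightarrow> ('p \<times> 'a \<times> 'p) set \<Rightarrow> 'a list set set \<Rightarrow> 'p \<Rightarrow> bool" where
  "op_acc Proc \<Sigma> T m p \<longleftrightarrow> (\<exists>D. D \<subseteq> fin_traces Proc \<Sigma> T p \<and> D \<in> m)"

definition op_sound ::
  "'p set \<Rightarrow> 'a set \<Rightarrow> ('p \<times> 'a \<times> 'p) set \<Rightarrow> 'a list set set \<Rightarrow> 'p set \<Rightarrow> bool" where
  "op_sound Proc \<Sigma> T m L \<longleftrightarrow> (\<forall>p\<in>Proc. op_acc Proc \<Sigma> T m p \<longrightarrow> p \<in> L)"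

definition op_monitorable ::
  "'p set \<Rightarrow> 'a set \<Rightarrow> ('p \<times> 'a \<times> 'p) set \<Rightarrow> 'p set \<Rightarrow> bool" where
  "op_monitorable Proc \<Sigma> T L \<longleftrightarrow>
     (\<exists>m. op_monitor \<Sigma> m \<and> op_sound Proc \<Sigma> T m L \<and> (\<forall>p\<in>L. op_acc Proc \<Sigma> T m p))"

end

theory Submission
  imports Defs
begin

text \<open>
  Finite intersections of the sets \<open>O(s)\<close> form a base of the topology, and \<open>p\<close> lies in
  the basic open set of a finite \<open>D\<close> iff \<open>D\<close> consists of traces of \<open>p\<close>. Hence \<open>L\<close> is open
  iff every \<open>p \<in> L\<close> has a finite set of traces whose basic open set is contained in \<open>L\<close>.
  In both senses, this makes the monitor answering yes exactly on the finite \<open>D\<close> whose basic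
  open set is contained in \<open>L\<close> a suitable one.
\<close>

text \<open>The body repeats the intersection in \<open>top_monitor\<close>, so that the soundness
  clause there becomes an inclusion of \<open>obs_base\<close> in \<open>L\<close>. At
  \<open>D = {}\<close> it yields the whole space.\<close>

definition obs_base :: "'p set \<Rightarrow> 'a set \<Rightarrow> ('p \<times> 'a \<times> 'p) set \<Rightarrow> 'a list set \<Rightarrow> 'p set" where
  "obs_base Proc \<Sigma> T D = Proc \<inter> (\<Inter>s\<in>D. obs Proc \<Sigma> T s)"

lemma mem_obs_base_iff:
  "p \<in> obs_base Proc \<Sigma> T D \<longleftrightarrow> p \<in> Proc \<and> D \<subseteq> fin_traces Proc \<Sigma> T p"
  by (auto simp: obs_base_def obs_def)

lemma obs_base_antimono: "C \<subseteq> D \<Longrightarrow> obs_base Proc \<Sigma> T D \<subseteq> obs_base Proc \<Sigma> T C"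
  by (auto simp: obs_base_def)

lemma obs_base_Un: "obs_base Proc \<Sigma> T (C \<union> D) = obs_base Proc \<Sigma> T C \<inter> obs_base Proc \<Sigma> T D"
  by (auto simp: obs_base_def)

lemma fin_traces_subset_lists: "fin_traces Proc \<Sigma> T p \<subseteq> lists \<Sigma>"
  by (auto simp: fin_traces_def)

lemma openin_obs_base:
  assumes "D \<in> fin_word_sets \<Sigma>"
  shows "openin (obs_topology Proc \<Sigma> T) (obs_base Proc \<Sigma> T D)"
\<comment> \<open>\<open>openin_INT2\<close> covers nonempty finite index sets; the empty
  intersection is the whole space, which is open.\<close>
proof (cases "D = {}")
  case True
  then show ?thesis
    using openin_topspace[of "obs_topology Proc \<Sigma> T"]
    by (simp add: obs_base_def topspace_obs_topology)
next
  case False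
  have "openin (obs_topology Proc \<Sigma> T) (\<Inter>s\<in>D. obs Proc \<Sigma> T s)"
    using False assms
    by (intro openin_INT2)
      (auto simp: fin_word_sets_def obs_topology_def intro!: topology_generated_by_Basis)
  then show ?thesis
    using openin_Int[OF openin_topspace[of "obs_topology Proc \<Sigma> T"]]
    by (simp add: obs_base_def topspace_obs_topology)
qed

text \<open>The local condition holds for the generators and survives unions and binary
  intersections, so induction on the generation of open sets gives one direction. Conversely, base
  sets are open, so the condition gives every point of \<open>L\<close> an open neighbourhood inside
  \<open>L\<close>.\<close>

lemma openin_obs_topology_iff:
  "openin (obs_topology Proc \<Sigma> T) L \<longleftrightarrow>
     (\<forall>p\<in>L. \<exists>D\<in>fin_word_sets \<Sigma>. p \<in> obs_base Proc \<Sigma> T D \<and> obs_base Proc \<Sigma> T D \<subseteq> L)"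
proof
  assume "openin (obs_topology Proc \<Sigma> T) L"
  then have "generate_topology_on (obs Proc \<Sigma> T ` lists \<Sigma>) L"
    by (simp add: obs_topology_def openin_topology_generated_by)
  then show "\<forall>p\<in>L. \<exists>D\<in>fin_word_sets \<Sigma>. p \<in> obs_base Proc \<Sigma> T D \<and> obs_base Proc \<Sigma> T D \<subseteq> L"
  proof (induction rule: generate_topology_on.induct)
    case Empty
    then show ?case by simp
  next
    case (Int A B)
    show ?case
    proof
      fix p assume "p \<in> A \<inter> B"
      with Int.IH obtain C D where
        "C \<in> fin_word_sets \<Sigma>" "p \<in> obs_base Proc \<Sigma> T C" "obs_base Proc \<Sigma> T C \<subseteq> A"
        "D \<in> fin_word_sets \<Sigma>" "p \<in> obs_base Proc \<Sigma> T D" "obs_base Proc \<Sigma> T D \<subseteq> B"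
        by blast
      \<comment> \<open>Requiring the words of both sets at once cuts out the intersection of the
        two base sets.\<close>
      then show "\<exists>D\<in>fin_word_sets \<Sigma>. p \<in> obs_base Proc \<Sigma> T D \<and> obs_base Proc \<Sigma> T D \<subseteq> A \<inter> B"
        by (intro bexI[of _ "C \<union> D"]) (auto simp: obs_base_Un fin_word_sets_def)
    qed
  next
    case (UN K)
    show ?case
    proof
      fix p assume "p \<in> \<Union>K"
      then obtain A where "A \<in> K" "p \<in> A"
        by blast
      with UN.IH obtain D where
        "D \<in> fin_word_sets \<Sigma>" "p \<in> obs_base Proc \<Sigma> T D" "obs_base Proc \<Sigma> T D \<subseteq> A"
        by blast
      with \<open>A \<in> K\<close>
      show "\<exists>D\<in>fin_word_sets \<Sigma>. p \<in> obs_base Proc \<Sigma> T D \<and> obs_base Proc \<Sigma> T D \<subseteq> \<Union>K"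
        by blast
    qed
  next
    case (Basis A)
    then obtain s where s: "s \<in> lists \<Sigma>" and A: "A = obs Proc \<Sigma> T s"
      by blast
    have "obs_base Proc \<Sigma> T {s} = A"
      by (auto simp: A obs_base_def obs_def)
    moreover have "{s} \<in> fin_word_sets \<Sigma>"
      using s by (simp add: fin_word_sets_def)
    ultimately show ?case by blast
  qed
next
  assume L: "\<forall>p\<in>L. \<exists>D\<in>fin_word_sets \<Sigma>. p \<in> obs_base Proc \<Sigma> T D \<and> obs_base Proc \<Sigma> T D \<subseteq> L"
  show "openin (obs_topology Proc \<Sigma> T) L"
  proof (rule openin_subopen[THEN iffD2], rule ballI)
    fix p assume "p \<in> L"
    with L obtain D where "D \<in> fin_word_sets \<Sigma>" "p \<in> obs_base Proc \<Sigma> T D" "obs_base Proc \<Sigma> T D \<subseteq> L"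
      by blast
    then show "\<exists>U. openin (obs_topology Proc \<Sigma> T) U \<and> p \<in> U \<and> U \<subseteq> L"
      by (intro exI[of _ "obs_base Proc \<Sigma> T D"] conjI openin_obs_base)
  qed
qed

lemma top_monitor_iff:
  "top_monitor Proc \<Sigma> T L m \<longleftrightarrow>
     (\<forall>C \<in> fin_word_sets \<Sigma>. \<forall>D \<in> fin_word_sets \<Sigma>.
        (m D = Yes \<longrightarrow> obs_base Proc \<Sigma> T D \<subseteq> L) \<and> (m C = Yes \<and> C \<subseteq> D \<longrightarrow> m D = Yes))"
  by (simp add: top_monitor_def obs_base_def)

text \<open>A finite set of traces of \<open>p\<close> that a monitor accepts defines a basic
  neighbourhood of \<open>p\<close>, which the soundness clause keeps inside \<open>L\<close>.
  Conversely, the neighbourhoods supplied by openness come from sets that may safely be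
  accepted.\<close>

lemma top_monitorable_iff_openin:
  assumes "L \<subseteq> Proc"
  shows "top_monitorable Proc \<Sigma> T L \<longleftrightarrow> openin (obs_topology Proc \<Sigma> T) L"
proof
  assume "top_monitorable Proc \<Sigma> T L"
  then obtain m where m: "top_monitor Proc \<Sigma> T L m"
    and ex: "\<forall>p\<in>L. \<exists>D. finite D \<and> D \<subseteq> fin_traces Proc \<Sigma> T p \<and> m D = Yes"
    unfolding top_monitorable_def by blast
  show "openin (obs_topology Proc \<Sigma> T) L"
    unfolding openin_obs_topology_iff
  proof
    fix p assume p: "p \<in> L"
    with ex obtain D where D: "finite D" "D \<subseteq> fin_traces Proc \<Sigma> T p" "m D = Yes"
      by blast
    \<comment> \<open>\<open>top_monitor\<close> constrains \<open>m\<close> only on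
      \<open>fin_word_sets \<Sigma>\<close>, so membership must come before soundness is
      used.\<close>
    have "D \<in> fin_word_sets \<Sigma>"
      using D(1) subset_trans[OF D(2) fin_traces_subset_lists] by (simp add: fin_word_sets_def)
    moreover have "p \<in> obs_base Proc \<Sigma> T D"
      using D p assms by (auto simp: mem_obs_base_iff)
    moreover have "obs_base Proc \<Sigma> T D \<subseteq> L"
      using m D \<open>D \<in> fin_word_sets \<Sigma>\<close> unfolding top_monitor_iff by blast
    ultimately
    show "\<exists>D\<in>fin_word_sets \<Sigma>. p \<in> obs_base Proc \<Sigma> T D \<and> obs_base Proc \<Sigma> T D \<subseteq> L"
      by blast
  qed
next
  assume op: "openin (obs_topology Proc \<Sigma> T) L"
  define m where "m D = (if obs_base Proc \<Sigma> T D \<subseteq> L then Yes else Unknown)" for D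
  have m_Yes: "m D = Yes \<longleftrightarrow> obs_base Proc \<Sigma> T D \<subseteq> L" for D
    by (simp add: m_def)
  \<comment> \<open>Monotonicity: enlarging \<open>D\<close> adds requirements, so its base set
    shrinks and stays inside \<open>L\<close>.\<close>
  have "top_monitor Proc \<Sigma> T L m"
    unfolding top_monitor_iff m_Yes by (meson obs_base_antimono order_trans)
  moreover have "\<exists>D. finite D \<and> D \<subseteq> fin_traces Proc \<Sigma> T p \<and> m D = Yes" if "p \<in> L" for p
    using op that by (auto simp: openin_obs_topology_iff m_Yes mem_obs_base_iff fin_word_sets_def)
  ultimately show "top_monitorable Proc \<Sigma> T L"
    unfolding top_monitorable_def by blast
qed

text \<open>The processes accepted by \<open>m\<close> are those lying in the base set of some
  \<open>D \<in> m\<close>. Soundness stated per process thus becomes soundness stated per set, as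
  in the topological sense.\<close>

lemma op_sound_iff:
  "op_sound Proc \<Sigma> T m L \<longleftrightarrow> (\<forall>D\<in>m. obs_base Proc \<Sigma> T D \<subseteq> L)"
proof
  assume sound: "op_sound Proc \<Sigma> T m L"
  show "\<forall>D\<in>m. obs_base Proc \<Sigma> T D \<subseteq> L"
  proof (intro ballI subsetI)
    fix D p assume "D \<in> m" "p \<in> obs_base Proc \<Sigma> T D"
    then have "p \<in> Proc" "op_acc Proc \<Sigma> T m p"
      unfolding op_acc_def mem_obs_base_iff by (simp, meson)
    with sound show "p \<in> L"
      by (simp add: op_sound_def)
  qed
next
  assume "\<forall>D\<in>m. obs_base Proc \<Sigma> T D \<subseteq> L"
  then show "op_sound Proc \<Sigma> T m L"
    unfolding op_sound_def op_acc_def by (meson mem_obs_base_iff subsetD)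
qed

lemma op_monitorable_iff_openin:
  assumes "L \<subseteq> Proc"
  shows "op_monitorable Proc \<Sigma> T L \<longleftrightarrow> openin (obs_topology Proc \<Sigma> T) L"
proof
  assume "op_monitorable Proc \<Sigma> T L"
  then obtain m where m: "op_monitor \<Sigma> m" "op_sound Proc \<Sigma> T m L" "\<forall>p\<in>L. op_acc Proc \<Sigma> T m p"
    unfolding op_monitorable_def by blast
  show "openin (obs_topology Proc \<Sigma> T) L"
    unfolding openin_obs_topology_iff
  proof
    fix p assume "p \<in> L"
    with m(3) obtain D where "D \<subseteq> fin_traces Proc \<Sigma> T p" "D \<in> m"
      unfolding op_acc_def by blast
    show "\<exists>D\<in>fin_word_sets \<Sigma>. p \<in> obs_base Proc \<Sigma> T D \<and> obs_base Proc \<Sigma> T D \<subseteq> L"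
    proof (intro bexI conjI)
      \<comment> \<open>Acceptance alone does not say that \<open>D\<close> is finite; this comes
        from \<open>m \<subseteq> fin_word_sets \<Sigma>\<close>.\<close>
      show "D \<in> fin_word_sets \<Sigma>"
        using m(1) \<open>D \<in> m\<close> unfolding op_monitor_def by (blast dest: subsetD)
      show "p \<in> obs_base Proc \<Sigma> T D"
        using \<open>p \<in> L\<close> assms \<open>D \<subseteq> fin_traces Proc \<Sigma> T p\<close> by (auto simp: mem_obs_base_iff)
      show "obs_base Proc \<Sigma> T D \<subseteq> L"
        using m(2) \<open>D \<in> m\<close> by (simp add: op_sound_iff)
    qed
  qed
next
  assume op: "openin (obs_topology Proc \<Sigma> T) L"
  define m where "m = {D \<in> fin_word_sets \<Sigma>. obs_base Proc \<Sigma> T D \<subseteq> L}"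
  \<comment> \<open>Upward closure is again antimonotonicity of \<open>obs_base\<close>.\<close>
  have "op_monitor \<Sigma> m"
    by (simp add: op_monitor_def m_def) (meson obs_base_antimono order_trans)
  moreover have "op_sound Proc \<Sigma> T m L"
    by (simp add: op_sound_iff m_def)
  moreover have "op_acc Proc \<Sigma> T m p" if "p \<in> L" for p
    using op that unfolding openin_obs_topology_iff op_acc_def m_def mem_obs_base_iff
    by (simp, meson)
  ultimately show "op_monitorable Proc \<Sigma> T L"
    unfolding op_monitorable_def by blast
qed

theorem theorem5p12:
  fixes Proc :: "'p set" and \<Sigma> :: "'a set" and T :: "('p \<times> 'a \<times> 'p) set" and L :: "'p set"
  assumes "lts Proc \<Sigma> T" and "finite \<Sigma>" and "L \<subseteq> Proc"
  shows "(openin (obs_topology Proc \<Sigma> T) L \<longleftrightarrow> top_monitorable Proc \<Sigma> T L) \<and>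
         (top_monitorable Proc \<Sigma> T L \<longleftrightarrow> op_monitorable Proc \<Sigma> T L)"
  using assms(3) by (simp add: top_monitorable_iff_openin op_monitorable_iff_openin)

end
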